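(* For every integer $n \geq 1$ the function $\phi_{\theta, n}:\mathbb{C}^n\to[0,\infty)$ is quasi-Young.
   Context: **Young and quasi-Young functions.** A function $\phi:\mathbb{C}^n\to[0,\infty)$ is quasi-Young if $\phi(0)=0$, $\lim_{t\to\infty}\phi(tx)=\infty$ for every $x\neq 0$, $\phi(e^{is}x)=\phi(x)$ for all $x\in\mathbb{C}^n$, $s\in\mathbb{R}$, and there is $C>0$ with $\phi(tx+(1-t)y)\le C(t\phi(x)+(1-t)\phi(y))$ for all $x,y\in\mathbb{C}^n$, $t\in[0,1]$. It is a Young function if it is convex (and has the other three properties). An Orlicz function is a Young function on $\mathbb{C}$; it satisfies $\phi(x)=\phi(|x|)$ and so is determined by its values on $[0,\infty)$. It is nondegenerate if $\phi(t)>0$ for $t>0$; then $\phi^{-1}$ denotes the inverse of $\phi|_{[0,\infty)}$. $\phi$ satisfies $\Delta_2$ if there is $M>0$ with $\phi(2x)\le M\phi(x)$ for all $x$. **Setting.** $\phi_0,\phi_1$ are nondegenerate Orlicz functions satisfying $\Delta_2$; it is also allowed that $\ell_{\phi_0}$ is replaced by $\ell_\infty$ or $c_0$, in which case $\phi_0^{-1}$ is taken to be the constant function $1$. $\theta\in(0,1)$ is fixed and $\phi_\theta$ is the Orlicz function given by $\phi_\theta^{-1}=(\phi_0^{-1})^{1-\theta}(\phi_1^{-1})^{\theta}$ on $[0,\infty)$. **The functions $\phi_{\theta,n}$.** Let $\mathbb{S}=\{z\in\mathbb{C}:0\le \mathrm{Re}(z)\le 1\}$ with interior $\mathbb{S}^{\mathrm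 o}$, and let $\varphi:\mathbb{S}\to\overline{\mathbb{D}}$ be a conformal map (continuous on $\mathbb{S}$, conformal from $\mathbb{S}^{\mathrm o}$ onto the open unit disk $\mathbb{D}$) with $\varphi(\theta)=0$. For a function $f$, $\hat f[j;z]=f^{(j)}(z)/j!$. Let $\mathrm{sgn}(z)=z/|z|$ for $z\ne0$, $\mathrm{sgn}(0)=0$. For $x\in\mathbb{C}$ put $g_x(z)=\phi_0^{-1}(\phi_\theta(|x|))^{1-z}\,\phi_1^{-1}(\phi_\theta(|x|))^{z}\,\mathrm{sgn}(x)$, $z\in\mathbb{S}$ (so $g_0\equiv 0$). For $n\ge2$ and $x=(x_{n-1},\dots,x_0)\in\mathbb{C}^n$ put $$g_x(z)=g_{(x_{n-2},\dots,x_0)}(z)+\frac{\varphi(z)^{n-1}}{k_n}\,g_{\,n!\,(x_{n-1}-\hat g_{(x_{n-2},\dots,x_0)}[n-1;\theta])}(z),\qquad k_n=n!\,\varphi'(\theta)^{n-1},$$ so that $\hat g_x[j;\theta]=x_j$ for $0\le j\le n-1$. Let $\phi_{\theta,1}=\phi_\theta$ and, for $n\ge2$, $$\phi_{\theta,n}(x_{n-1},\dots,x_0)=\phi_{\theta,n-1}(x_{n-2},\dots,x_0)+\phi_\theta\big(x_{n-1}-\hat g_{(x_{n-2},\dots,x_0)}[n-1;\theta]\big).$$ *)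

theory Defs
  imports "HOL-Complex_Analysis.Complex_Analysis"
begin

text \<open>A vector \<open>(x\<^sub>n\<^sub>-\<^sub>1, \<dots>, x\<^sub>0)\<close> of \<open>\<complex>\<^sup>n\<close> is the function \<open>i \<mapsto> x\<^sub>i\<close>, extended by \<open>0\<close> to all
  indices \<open>i \<ge> n\<close>. The same function read at a smaller \<open>n\<close> stands for its tail
  \<open>(x\<^sub>n\<^sub>-\<^sub>2, \<dots>, x\<^sub>0)\<close>.\<close>

definition Cn :: "nat \<Rightarrow> (nat \<Rightarrow> complex) set" where
  "Cn n = {x. \<forall>i\<ge>n. x i = 0}"

definition quasi_young :: "nat \<Rightarrow> ((nat \<Rightarrow> complex) \<Rightarrow> real) \<Rightarrow> bool" where
  "quasi_young n \<phi> \<longleftrightarrow>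
     (\<forall>x\<in>Cn n. 0 \<le> \<phi> x) \<and>
     \<phi> (\<lambda>_. 0) = 0 \<and>
     (\<forall>x\<in>Cn n. x \<noteq> (\<lambda>_. 0) \<longrightarrow>
        filterlim (\<lambda>t::real. \<phi> (\<lambda>i. of_real t * x i)) at_top at_top) \<and>
     (\<forall>x\<in>Cn n. \<forall>s::real. \<phi> (\<lambda>i. exp (\<i> * of_real s) * x i) = \<phi> x) \<and>
     (\<exists>C>0. \<forall>x\<in>Cn n. \<forall>y\<in>Cn n. \<forall>t\<in>{0..1::real}.
        \<phi> (\<lambda>i. of_real t * x i + of_real (1 - t) * y i) \<le> C * (t * \<phi> x + (1 - t) * \<phi> y))"

definition orlicz :: "(complex \<Rightarrow> real) \<Rightarrow> bool" where
  "orlicz \<phi> \<longleftrightarrow>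
     (\<forall>x. 0 \<le> \<phi> x) \<and>
     \<phi> 0 = 0 \<and>
     (\<forall>x. x \<noteq> 0 \<longrightarrow> filterlim (\<lambda>t::real. \<phi> (of_real t * x)) at_top at_top) \<and>
     (\<forall>x. \<forall>s::real. \<phi> (exp (\<i> * of_real s) * x) = \<phi> x) \<and>
     convex_on UNIV \<phi>"

definition nondegenerate :: "(complex \<Rightarrow> real) \<Rightarrow> bool" where
  "nondegenerate \<phi> \<longleftrightarrow> (\<forall>t::real. 0 < t \<longrightarrow> 0 < \<phi> (of_real t))"

definition delta2 :: "(complex \<Rightarrow> real) \<Rightarrow> bool" where
  "delta2 \<phi> \<longleftrightarrow> (\<exists>M>0. \<forall>x. \<phi> (2 * x) \<le> M * \<phi> x)"

definition orlicz_inv :: "(complex \<Rightarrow> real) \<Rightarrow> real \<Rightarrow> real" where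
  "orlicz_inv \<phi> = the_inv_into {0..} (\<lambda>t. \<phi> (of_real t))"

text \<open>The left endpoint space is an Orlicz sequence space, \<open>\<ell>\<^sub>\<infinity>\<close> or \<open>c\<^sub>0\<close>; in the last two cases
  \<open>\<phi>\<^sub>0\<close> does not exist, and only the convention \<open>\<phi>\<^sub>0\<^sup>-\<^sup>1 = 1\<close> is used.\<close>

datatype left_endpoint = Orlicz_space "complex \<Rightarrow> real" | Ell_infinity | C_zero

fun left_admissible :: "left_endpoint \<Rightarrow> bool" where
  "left_admissible (Orlicz_space \<phi>) \<longleftrightarrow> orlicz \<phi> \<and> nondegenerate \<phi> \<and> delta2 \<phi>"
| "left_admissible Ell_infinity \<longleftrightarrow> True"
| "left_admissible C_zero \<longleftrightarrow> True"

fun left_inv :: "left_endpoint \<Rightarrow> real \<Rightarrow> real" where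
  "left_inv (Orlicz_space \<phi>) = orlicz_inv \<phi>"
| "left_inv Ell_infinity = (\<lambda>_. 1)"
| "left_inv C_zero = (\<lambda>_. 1)"

definition strip :: "complex set" where
  "strip = {z. 0 \<le> Re z \<and> Re z \<le> 1}"

definition conformal_strip_disc :: "(complex \<Rightarrow> complex) \<Rightarrow> bool" where
  "conformal_strip_disc \<psi> \<longleftrightarrow>
     continuous_on strip \<psi> \<and> \<psi> ` strip \<subseteq> cball 0 1 \<and>
     \<psi> holomorphic_on interior strip \<and> bij_betw \<psi> (interior strip) (ball 0 1)"

definition taylor_coeff :: "(complex \<Rightarrow> complex) \<Rightarrow> nat \<Rightarrow> complex \<Rightarrow> complex" where
  "taylor_coeff f j z = (deriv ^^ j) f z / fact j"

text \<open>From here on \<open>p\<close> and \<open>q\<close> stand for \<open>\<phi>\<^sub>0\<^sup>-\<^sup>1\<close> and \<open>\<phi>\<^sub>1\<^sup>-\<^sup>1\<close>, and \<open>\<psi>\<close> for the conformal map.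
  \<open>phi_theta p q \<theta>\<close> is the rotation invariant function on \<open>\<complex>\<close> whose restriction to \<open>[0,\<infinity>)\<close> has
  inverse \<open>p\<^sup>1\<^sup>-\<^sup>\<theta> q\<^sup>\<theta>\<close>.\<close>

definition phi_theta :: "(real \<Rightarrow> real) \<Rightarrow> (real \<Rightarrow> real) \<Rightarrow> real \<Rightarrow> complex \<Rightarrow> real" where
  "phi_theta p q \<theta> x = the_inv_into {0..} (\<lambda>s. p s powr (1 - \<theta>) * q s powr \<theta>) (cmod x)"

definition g_one ::
  "(real \<Rightarrow> real) \<Rightarrow> (real \<Rightarrow> real) \<Rightarrow> real \<Rightarrow> complex \<Rightarrow> complex \<Rightarrow> complex" where
  "g_one p q \<theta> x z =
     of_real (p (phi_theta p q \<theta> (of_real (cmod x)))) powr (1 - z) *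
     of_real (q (phi_theta p q \<theta> (of_real (cmod x)))) powr z * sgn x"

definition k_const :: "(complex \<Rightarrow> complex) \<Rightarrow> real \<Rightarrow> nat \<Rightarrow> complex" where
  "k_const \<psi> \<theta> n = fact n * deriv \<psi> (of_real \<theta>) ^ (n - 1)"

text \<open>In the last equations of \<open>g_vec\<close> and \<open>phi_theta_n\<close> the dimension is \<open>n = m + 2\<close>.
  The values in dimension \<open>0\<close> are irrelevant.\<close>

fun g_vec ::
  "(real \<Rightarrow> real) \<Rightarrow> (real \<Rightarrow> real) \<Rightarrow> real \<Rightarrow> (complex \<Rightarrow> complex) \<Rightarrow>
   nat \<Rightarrow> (nat \<Rightarrow> complex) \<Rightarrow> complex \<Rightarrow> complex" where
  "g_vec p q \<theta> \<psi> 0 x = (\<lambda>z. 0)"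
| "g_vec p q \<theta> \<psi> (Suc 0) x = g_one p q \<theta> (x 0)"
| "g_vec p q \<theta> \<psi> (Suc (Suc m)) x = (\<lambda>z.
     g_vec p q \<theta> \<psi> (Suc m) x z +
     \<psi> z ^ (m + 1) / k_const \<psi> \<theta> (m + 2) *
     g_one p q \<theta>
       (fact (m + 2) *
        (x (m + 1) - taylor_coeff (g_vec p q \<theta> \<psi> (Suc m) x) (m + 1) (of_real \<theta>))) z)"

fun phi_theta_n ::
  "(real \<Rightarrow> real) \<Rightarrow> (real \<Rightarrow> real) \<Rightarrow> real \<Rightarrow> (complex \<Rightarrow> complex) \<Rightarrow>
   nat \<Rightarrow> (nat \<Rightarrow> complex) \<Rightarrow> real" where
  "phi_theta_n p q \<theta> \<psi> 0 x = 0"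
| "phi_theta_n p q \<theta> \<psi> (Suc 0) x = phi_theta p q \<theta> (x 0)"
| "phi_theta_n p q \<theta> \<psi> (Suc (Suc m)) x =
     phi_theta_n p q \<theta> \<psi> (Suc m) x +
     phi_theta p q \<theta>
       (x (m + 1) - taylor_coeff (g_vec p q \<theta> \<psi> (Suc m) x) (m + 1) (of_real \<theta>))"

end

theory Submission imports Defs begin

text \<open>Write \<open>p = \<phi>\<^sub>0\<^sup>-\<^sup>1\<close>, \<open>q = \<phi>\<^sub>1\<^sup>-\<^sup>1\<close> and \<open>w = p\<^sup>1\<^sup>-\<^sup>\<theta> q\<^sup>\<theta> = \<phi>\<^sub>\<theta>\<^sup>-\<^sup>1\<close>. The function \<open>g\<^sub>x\<close> is bounded on the
  two boundary lines of the strip by multiples of \<open>p (\<phi>\<^sub>\<theta>\<^sub>,\<^sub>n x)\<close> and \<open>q (\<phi>\<^sub>\<theta>\<^sub>,\<^sub>n x)\<close>, so by concavity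
  \<open>f = t g\<^sub>x + (1 - t) g\<^sub>y\<close> is bounded there by multiples of \<open>p R\<close> and \<open>q R\<close> with
  \<open>R = t \<phi>\<^sub>\<theta>\<^sub>,\<^sub>n x + (1 - t) \<phi>\<^sub>\<theta>\<^sub>,\<^sub>n y\<close>. Conversely, such bounds on any \<open>f\<close> with Taylor coefficients \<open>z\<^sub>j\<close>
  at \<open>\<theta>\<close> force \<open>\<phi>\<^sub>\<theta>\<^sub>,\<^sub>n z \<le> C R\<close>: inductively \<open>F = f - g\<^sub>z\<close> (for the first \<open>m\<close> entries of \<open>z\<close>) satisfies
  bounds of the same kind and vanishes to order \<open>m\<close> at \<open>\<theta>\<close>. The function
  \<open>F(u) (p R)\<^sup>u\<^sup>-\<^sup>1 (q R)\<^sup>-\<^sup>u\<close> is bounded by a constant on the strip, and Cauchy's estimate for its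
  \<open>m\<close>-th coefficient bounds that of \<open>F\<close>, the argument of the next \<open>\<phi>\<^sub>\<theta>\<close>, by a multiple of \<open>w R\<close>.
  Since \<open>\<phi>\<^sub>\<theta>\<close> inherits \<open>\<Delta>\<^sub>2\<close>, the next summand is at most a multiple of \<open>R\<close>.\<close>

subsection \<open>Bounded holomorphic functions on the strip\<close>

lemma interior_strip: "interior strip = {z. 0 < Re z \<and> Re z < 1}"
proof -
  have "strip = {z. (1::complex) \<bullet> z \<ge> 0} \<inter> {z. (1::complex) \<bullet> z \<le> 1}"
    by (auto simp: strip_def inner_complex_def)
  then have "interior strip = interior {z. (1::complex) \<bullet> z \<ge> 0} \<inter> interior {z. (1::complex) \<bullet> z \<le> 1}"
    by (metis interior_Int)
  then show ?thesis
    by (subst (asm) interior_halfspace_ge, simp, subst (asm) interior_halfspace_le)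
       (auto simp: inner_complex_def)
qed

lemma cball_subset_strip:
  assumes "r \<le> \<theta>" "r \<le> 1 - \<theta>"
  shows "cball (complex_of_real \<theta>) r \<subseteq> strip"
proof
  fix z assume "z \<in> cball (complex_of_real \<theta>) r"
  then have "\<bar>Re z - \<theta>\<bar> \<le> r"
    using abs_Re_le_cmod[of "z - of_real \<theta>"] by (simp add: dist_norm norm_minus_commute)
  then show "z \<in> strip"
    using assms by (auto simp: strip_def)
qed

text \<open>Boundedness belongs to the class because the maximum principle on the unbounded strip
  fails without it: \<open>exp (- \<i> * exp (\<i> * pi * z))\<close> has modulus 1 on both boundary
  lines and is unbounded inside.\<close>

definition bounded_holomorphic_strip :: "(complex \<Rightarrow> complex) \<Rightarrow> bool" where
  "bounded_holomorphic_strip f \<longleftrightarrow>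
     continuous_on strip f \<and> f holomorphic_on interior strip \<and> bounded (f ` strip)"

lemma bounded_holomorphic_strip_add:
  assumes "bounded_holomorphic_strip f" "bounded_holomorphic_strip g"
  shows "bounded_holomorphic_strip (\<lambda>z. f z + g z)"
  using assms
  by (auto simp: bounded_holomorphic_strip_def intro!: continuous_intros holomorphic_intros bounded_plus_comp)

lemma bounded_holomorphic_strip_diff:
  assumes "bounded_holomorphic_strip f" "bounded_holomorphic_strip g"
  shows "bounded_holomorphic_strip (\<lambda>z. f z - g z)"
  using assms
  by (auto simp: bounded_holomorphic_strip_def intro!: continuous_intros holomorphic_intros bounded_minus_comp)

lemma bounded_holomorphic_strip_const: "bounded_holomorphic_strip (\<lambda>z. c)"
  by (auto simp: bounded_holomorphic_strip_def bounded_iff)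

lemma bounded_holomorphic_strip_mult:
  assumes "bounded_holomorphic_strip f" "bounded_holomorphic_strip g"
  shows "bounded_holomorphic_strip (\<lambda>z. f z * g z)"
proof -
  obtain F where F: "\<And>z. z \<in> strip \<Longrightarrow> cmod (f z) \<le> F"
    using assms(1) by (auto simp: bounded_holomorphic_strip_def bounded_iff)
  obtain G where G: "\<And>z. z \<in> strip \<Longrightarrow> cmod (g z) \<le> G"
    using assms(2) by (auto simp: bounded_holomorphic_strip_def bounded_iff)
  have "cmod (f z * g z) \<le> F * G" if "z \<in> strip" for z
    unfolding norm_mult using F[OF that] G[OF that]
    by (intro mult_mono) (auto intro: order_trans[OF norm_ge_zero])
  then have "bounded ((\<lambda>z. f z * g z) ` strip)"
    by (auto simp: bounded_iff)
  with assms show ?thesis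
    by (auto simp: bounded_holomorphic_strip_def intro!: continuous_intros holomorphic_intros)
qed

lemma bounded_holomorphic_strip_power:
  assumes "bounded_holomorphic_strip f"
  shows "bounded_holomorphic_strip (\<lambda>z. f z ^ m)"
proof (induction m)
  case 0
  then show ?case by (simp add: bounded_holomorphic_strip_const)
next
  case (Suc m)
  then show ?case using bounded_holomorphic_strip_mult[OF assms] by simp
qed

lemma norm_powr_mix:
  assumes "0 < P" "0 < Q"
  shows "cmod (of_real P powr (1 - z) * of_real Q powr z) = P powr (1 - Re z) * Q powr Re z"
  using assms by (simp add: norm_mult norm_powr_real_powr)

lemma powr_mix_le:
  fixes P Q x :: real
  assumes "0 < P" "0 < Q" "0 \<le> x" "x \<le> 1"
  shows "P powr (1 - x) * Q powr x \<le> max P Q"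
proof -
  have "P powr (1 - x) * Q powr x \<le> max P Q powr (1 - x) * max P Q powr x"
    using assms by (intro mult_mono powr_mono2) auto
  also have "\<dots> = max P Q"
    using assms by (simp flip: powr_add)
  finally show ?thesis .
qed

text \<open>Up to a constant factor these are the functions \<open>g_one\<close>; with reciprocal
  bases they serve as weights that equalise different bounds on the two boundary lines.\<close>

lemma bounded_holomorphic_strip_powr:
  assumes "0 < P" "0 < Q"
  shows "bounded_holomorphic_strip (\<lambda>z. of_real P powr (1 - z) * of_real Q powr z)"
proof -
  have "bounded ((\<lambda>z. complex_of_real P powr (1 - z) * of_real Q powr z) ` strip)"
    unfolding bounded_iff using assms
    by (intro exI[of _ "max P Q"]) (auto simp: norm_powr_mix strip_def intro!: powr_mix_le)
  then show ?thesis
    using assms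
    by (auto simp: bounded_holomorphic_strip_def powr_def intro!: continuous_intros holomorphic_intros)
qed

text \<open>Multiplying by \<open>1 / (1 + \<epsilon> z)\<close>, which has modulus at most \<open>1\<close> on the strip and decays at
  infinity, reduces the claim to the maximum principle on large rectangles.\<close>

lemma strip_maximum_principle:
  assumes f: "bounded_holomorphic_strip f"
    and bd: "\<And>z. Re z = 0 \<or> Re z = 1 \<Longrightarrow> cmod (f z) \<le> A"
    and "0 < A" and z: "z \<in> strip"
  shows "cmod (f z) \<le> A"
proof -
  obtain L where L: "\<And>z. z \<in> strip \<Longrightarrow> cmod (f z) \<le> L"
    using f by (auto simp: bounded_holomorphic_strip_def bounded_iff)
  have "0 \<le> L" using L[OF z] norm_ge_zero order_trans by blast
  have contf: "continuous_on strip f" and holf: "f holomorphic_on interior strip"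
    using f by (auto simp: bounded_holomorphic_strip_def)
  have bound: "cmod (f z) \<le> A * (1 + \<epsilon> * cmod z)" if "0 < \<epsilon>" for \<epsilon>
  proof -
    \<comment> \<open>This height puts \<open>z\<close> inside the rectangle and makes
      \<open>A * (\<epsilon> * T)\<close> at least the crude bound \<open>L\<close>, so that on the
      horizontal sides division by \<open>1 + \<epsilon> z\<close> brings the modulus below
      \<open>A\<close>.\<close>
    define T where "T = max \<bar>Im z\<bar> (L / (\<epsilon> * A)) + 1"
    have "0 < T" by (simp add: T_def add_nonneg_pos le_max_iff_disj)
    have T: "\<bar>Im z\<bar> \<le> T" "L \<le> A * (\<epsilon> * T)"
    proof -
      show "\<bar>Im z\<bar> \<le> T" by (simp add: T_def)
      have "L / (\<epsilon> * A) \<le> T" by (simp add: T_def)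
      then show "L \<le> A * (\<epsilon> * T)"
        using \<open>0 < \<epsilon>\<close> \<open>0 < A\<close> by (simp add: field_simps)
    qed
    define S where "S = cbox (Complex 0 (-T)) (Complex 1 T)"
    have S: "S \<subseteq> strip" by (auto simp: S_def in_cbox_complex_iff strip_def)
    have intS: "interior S \<subseteq> interior strip" by (intro interior_mono S)
    define h where "h = (\<lambda>z. f z / (1 + of_real \<epsilon> * z))"
    have ge1: "1 \<le> cmod (1 + of_real \<epsilon> * u)" if "u \<in> strip" for u
    proof -
      have "1 \<le> Re (1 + of_real \<epsilon> * u)" using that \<open>0 < \<epsilon>\<close> by (simp add: strip_def)
      then show ?thesis using complex_Re_le_cmod order_trans by blast
    qed
    then have nz: "1 + of_real \<epsilon> * u \<noteq> 0" if "u \<in> strip" for u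
      using that by fastforce
    have "cmod (h z) \<le> A"
    proof (rule maximum_modulus_frontier[where S = S and f = h and \<xi> = z])
      show "h holomorphic_on interior S"
        unfolding h_def using nz S interior_subset[of S] holomorphic_on_subset[OF holf intS]
        by (auto intro!: holomorphic_intros)
      show "continuous_on (closure S) h"
        using nz S continuous_on_subset[OF contf S]
        by (auto simp: h_def S_def intro!: continuous_intros)
      show "bounded S" by (simp add: S_def bounded_cbox)
      show "z \<in> S" using z T by (auto simp: S_def in_cbox_complex_iff strip_def)
    next
      fix u assume "u \<in> frontier S"
      then have u: "u \<in> S" and disj: "Re u = 0 \<or> Re u = 1 \<or> \<bar>Im u\<bar> = T"
        by (auto simp: S_def frontier_cbox in_cbox_complex_iff in_box_complex_iff)
      have us: "u \<in> strip" using u S by auto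
      have "cmod (f u) \<le> A * cmod (1 + of_real \<epsilon> * u)"
      proof (cases "Re u = 0 \<or> Re u = 1")
        case True
        then have "cmod (f u) \<le> A * 1" using bd by auto
        also have "\<dots> \<le> A * cmod (1 + of_real \<epsilon> * u)"
          using ge1[OF us] \<open>0 < A\<close> by (intro mult_left_mono) auto
        finally show ?thesis .
      next
        case False
        then have "\<epsilon> * T = \<bar>Im (1 + of_real \<epsilon> * u)\<bar>"
          using disj \<open>0 < \<epsilon>\<close> by (auto simp: abs_mult)
        then have "\<epsilon> * T \<le> cmod (1 + of_real \<epsilon> * u)"
          using abs_Im_le_cmod by metis
        then have "A * (\<epsilon> * T) \<le> A * cmod (1 + of_real \<epsilon> * u)"
          using \<open>0 < A\<close> by (intro mult_left_mono) auto
        then show ?thesis using L[OF us] T(2) by linarith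
      qed
      then show "cmod (h u) \<le> A"
        using nz[OF us] by (simp add: h_def norm_divide field_simps)
    qed
    then have "cmod (f z) \<le> A * cmod (1 + of_real \<epsilon> * z)"
      using nz[OF z] by (simp add: h_def norm_divide field_simps)
    also have "\<dots> \<le> A * (1 + \<epsilon> * cmod z)"
      using \<open>0 < A\<close> \<open>0 < \<epsilon>\<close> norm_triangle_ineq[of 1 "of_real \<epsilon> * z"]
      by (intro mult_left_mono) (auto simp: norm_mult)
    finally show ?thesis .
  qed
  show ?thesis
  proof (rule field_le_epsilon)
    fix e :: real assume "0 < e"
    define \<epsilon> where "\<epsilon> = e / (A * (cmod z + 1))"
    have "0 < \<epsilon>" using \<open>0 < e\<close> \<open>0 < A\<close> by (auto simp: \<epsilon>_def intro!: divide_pos_pos mult_pos_pos add_nonneg_pos)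
    have "A * (\<epsilon> * cmod z) \<le> A * (\<epsilon> * (cmod z + 1))"
      using \<open>0 < \<epsilon>\<close> \<open>0 < A\<close> by (intro mult_left_mono) auto
    also have "\<dots> = e"
      using \<open>0 < A\<close> add_nonneg_pos[OF norm_ge_zero zero_less_one, of z] by (simp add: \<epsilon>_def)
    finally show "cmod (f z) \<le> A + e"
      using bound[OF \<open>0 < \<epsilon>\<close>] by (simp add: algebra_simps)
  qed
qed

section \<open>Order of vanishing and the lowest Taylor coefficient\<close>

lemma higher_deriv_mult_lowest:
  fixes f g :: "complex \<Rightarrow> complex"
  assumes "f holomorphic_on S" "g holomorphic_on S" "open S" "\<xi> \<in> S"
    and "\<And>j. j < m \<Longrightarrow> (deriv ^^ j) f \<xi> = 0"
  shows "j < m \<Longrightarrow> (deriv ^^ j) (\<lambda>z. f z * g z) \<xi> = 0"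
    and "(deriv ^^ m) (\<lambda>z. f z * g z) \<xi> = (deriv ^^ m) f \<xi> * g \<xi>"
proof -
  show "(deriv ^^ j) (\<lambda>z. f z * g z) \<xi> = 0" if "j < m"
    unfolding higher_deriv_mult[OF assms(1-4)] using that assms(5) by (intro sum.neutral) auto
  \<comment> \<open>In the Leibniz sum all terms with \<open>i < m\<close> contain a vanishing
    derivative of \<open>f\<close>; only \<open>i = m\<close> survives.\<close>
  have "(deriv ^^ m) (\<lambda>z. f z * g z) \<xi>
      = (\<Sum>i\<in>{m}. of_nat (m choose i) * (deriv ^^ i) f \<xi> * (deriv ^^ (m - i)) g \<xi>)"
    unfolding higher_deriv_mult[OF assms(1-4)] using assms(5) by (intro sum.mono_neutral_right) auto
  then show "(deriv ^^ m) (\<lambda>z. f z * g z) \<xi> = (deriv ^^ m) f \<xi> * g \<xi>" by simp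
qed

text \<open>The Leibniz rule is applied to \<open>f ^ m * f\<close>. At order \<open>m + 1\<close>
  the terms with \<open>i < m\<close> vanish by induction and the one with \<open>i = m + 1\<close>
  because \<open>f \<xi> = 0\<close>; the binomial coefficient of the remaining term extends the
  factorial.\<close>

lemma higher_deriv_power_at_zero:
  fixes f :: "complex \<Rightarrow> complex"
  assumes "f holomorphic_on S" "open S" "\<xi> \<in> S" "f \<xi> = 0"
  shows "j < m \<Longrightarrow> (deriv ^^ j) (\<lambda>z. f z ^ m) \<xi> = 0"
    and "(deriv ^^ m) (\<lambda>z. f z ^ m) \<xi> = fact m * deriv f \<xi> ^ m"
proof (induction m arbitrary: j)
  case (Suc m)
  have hol: "(\<lambda>z. f z ^ m) holomorphic_on S" using assms(1) by (intro holomorphic_intros)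
  note mult = higher_deriv_mult[OF hol assms(1-3)]
  {
    case 1
    have "of_nat (j choose i) * (deriv ^^ i) (\<lambda>z. f z ^ m) \<xi> * (deriv ^^ (j - i)) f \<xi> = 0"
      if "i \<in> {0..j}" for i
      using that 1 Suc.IH(1)[of i] assms(4) by (cases "i < m") auto
    then show ?case
      unfolding power_Suc2 mult by (intro sum.neutral) blast
  next
    case 2
    have "of_nat (Suc m choose i) * (deriv ^^ i) (\<lambda>z. f z ^ m) \<xi> * (deriv ^^ (Suc m - i)) f \<xi> = 0"
      if "i \<in> {0..Suc m} - {m}" for i
      using that Suc.IH(1)[of i] assms(4) by (cases "i < m") (auto simp: not_less le_Suc_eq)
    then have "(deriv ^^ Suc m) (\<lambda>z. f z ^ Suc m) \<xi> =
      (\<Sum>i\<in>{m}. of_nat (Suc m choose i) * (deriv ^^ i) (\<lambda>z. f z ^ m) \<xi> * (deriv ^^ (Suc m - i)) f \<xi>)"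
      unfolding power_Suc2 mult by (intro sum.mono_neutral_right) auto
    then show ?case using Suc.IH(2) by (simp add: algebra_simps)
  }
qed simp_all

text \<open>Multiplying by a weight mixes Taylor coefficients in general, but the
  \<open>m\<close>-th one is merely rescaled by the value of the weight at \<theta> when all lower
  ones vanish.\<close>

lemma lowest_taylor_coeff_le:
  assumes f: "bounded_holomorphic_strip f"
    and bd0: "\<And>z. Re z = 0 \<Longrightarrow> cmod (f z) \<le> A * P"
    and bd1: "\<And>z. Re z = 1 \<Longrightarrow> cmod (f z) \<le> A * Q"
    and pos: "0 < A" "0 < P" "0 < Q" "0 < \<theta>" "\<theta> < 1"
    and zero: "\<And>j. j < m \<Longrightarrow> (deriv ^^ j) f (of_real \<theta>) = 0"
  shows "cmod (taylor_coeff f m (of_real \<theta>)) \<le> A / min \<theta> (1 - \<theta>) ^ m * (P powr (1 - \<theta>) * Q powr \<theta>)"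
proof -
  \<comment> \<open>The modulus of \<open>N\<close> is \<open>1 / P\<close> on the left line and
    \<open>1 / Q\<close> on the right one, so the single constant \<open>A\<close> bounds
    \<open>f * N\<close> on both.\<close>
  define N where "N = (\<lambda>z. complex_of_real (inverse P) powr (1 - z) * of_real (inverse Q) powr z)"
  \<comment> \<open>The largest radius of a closed disc about \<theta> inside the strip, for
    Cauchy's estimate.\<close>
  define r where "r = min \<theta> (1 - \<theta>)"
  define W where "W = P powr (1 - \<theta>) * Q powr \<theta>"
  have "0 < W" using pos by (simp add: W_def)
  have N: "bounded_holomorphic_strip N"
    unfolding N_def using pos by (intro bounded_holomorphic_strip_powr) auto
  have normN: "cmod (N z) = inverse P powr (1 - Re z) * inverse Q powr Re z" for z
    unfolding N_def using pos by (intro norm_powr_mix) auto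
  have G: "bounded_holomorphic_strip (\<lambda>z. f z * N z)"
    using f N by (rule bounded_holomorphic_strip_mult)
  have le: "cmod (f z * N z) \<le> A" if "z \<in> strip" for z
  proof (rule strip_maximum_principle[OF G _ pos(1) that])
    fix u assume "Re u = 0 \<or> Re u = 1"
    then show "cmod (f u * N u) \<le> A"
    proof
      assume "Re u = 0"
      then show ?thesis using bd0[of u] pos by (simp add: norm_mult normN field_simps)
    next
      assume "Re u = 1"
      then show ?thesis using bd1[of u] pos by (simp add: norm_mult normN field_simps)
    qed
  qed
  have r: "0 < r" "r \<le> \<theta>" "r \<le> 1 - \<theta>" using pos by (auto simp: r_def)
  note cb = cball_subset_strip[OF r(2,3)]
  have b: "ball (complex_of_real \<theta>) r \<subseteq> interior strip"
    using interior_mono[OF cb] by simp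
  have "cmod ((deriv ^^ m) (\<lambda>z. f z * N z) (of_real \<theta>)) \<le> fact m * A / r ^ m"
  proof (rule Cauchy_inequality)
    show "(\<lambda>z. f z * N z) holomorphic_on ball (of_real \<theta>) r"
      "continuous_on (cball (of_real \<theta>) r) (\<lambda>z. f z * N z)"
      using G b cb by (auto simp: bounded_holomorphic_strip_def intro: holomorphic_on_subset continuous_on_subset)
    show "cmod (f x * N x) \<le> A" if "cmod (of_real \<theta> - x) = r" for x
      using that cb by (intro le) (auto simp: dist_norm)
  qed fact
  also have "(deriv ^^ m) (\<lambda>z. f z * N z) (of_real \<theta>) = (deriv ^^ m) f (of_real \<theta>) * N (of_real \<theta>)"
    using f N zero b \<open>0 < r\<close>
    by (intro higher_deriv_mult_lowest(2)[where S = "interior strip"])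
       (auto simp: bounded_holomorphic_strip_def)
  finally have "cmod ((deriv ^^ m) f (of_real \<theta>)) * cmod (N (of_real \<theta>)) \<le> fact m * A / r ^ m"
    by (simp add: norm_mult)
  moreover have "cmod (N (of_real \<theta>)) = inverse W"
    using pos by (simp add: normN W_def inverse_powr)
  ultimately have "cmod ((deriv ^^ m) f (of_real \<theta>)) * inverse W \<le> fact m * A / r ^ m"
    by simp
  then have "cmod ((deriv ^^ m) f (of_real \<theta>)) / fact m \<le> A / r ^ m * W"
    using \<open>0 < W\<close> r by (simp add: field_simps)
  then show ?thesis
    by (simp add: taylor_coeff_def norm_divide r_def W_def)
qed

lemma taylor_coeff_add:
  assumes "bounded_holomorphic_strip f" "bounded_holomorphic_strip g" "\<xi> \<in> interior strip"
  shows "taylor_coeff (\<lambda>z. f z + g z) j \<xi> = taylor_coeff f j \<xi> + taylor_coeff g j \<xi>"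
  using assms higher_deriv_add[of f "interior strip" g \<xi> j]
  by (simp add: taylor_coeff_def bounded_holomorphic_strip_def add_divide_distrib)

lemma taylor_coeff_diff:
  assumes "bounded_holomorphic_strip f" "bounded_holomorphic_strip g" "\<xi> \<in> interior strip"
  shows "taylor_coeff (\<lambda>z. f z - g z) j \<xi> = taylor_coeff f j \<xi> - taylor_coeff g j \<xi>"
  using assms higher_deriv_diff[of f "interior strip" g \<xi> j]
  by (simp add: taylor_coeff_def bounded_holomorphic_strip_def diff_divide_distrib)

lemma taylor_coeff_cmult:
  assumes "bounded_holomorphic_strip f" "\<xi> \<in> interior strip"
  shows "taylor_coeff (\<lambda>z. c * f z) j \<xi> = c * taylor_coeff f j \<xi>"
  using assms higher_deriv_cmult[of f "interior strip" \<xi> j c]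
  by (simp add: taylor_coeff_def bounded_holomorphic_strip_def)

lemma taylor_coeff_zero [simp]: "taylor_coeff (\<lambda>z. 0) j \<xi> = 0"
  by (simp add: taylor_coeff_def)

subsection \<open>Concave functions and their geometric mean\<close>

text \<open>The point \<open>s\<close> is a convex combination of \<open>0\<close> and
  \<open>c * s\<close>, with weight \<open>1 / c\<close> on the latter. Later this pulls constants
  out of \<open>p\<close> and \<open>q\<close>.\<close>

lemma concave_subhomogeneous:
  fixes f :: "real \<Rightarrow> real"
  assumes f: "concave_on {0..} f" and "0 \<le> f 0" and "1 \<le> c" and "0 \<le> s"
  shows "f (c * s) \<le> c * f s"
proof -
  have "(1 - 1 / c) * f 0 + 1 / c * f (c * s) \<le> f ((1 - 1 / c) *\<^sub>R 0 + (1 / c) *\<^sub>R (c * s))"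
    using assms by (intro concave_onD[OF f]) auto
  moreover have "0 \<le> (1 - 1 / c) * f 0"
    using assms by simp
  ultimately have "1 / c * f (c * s) \<le> f s"
    using \<open>1 \<le> c\<close> by simp
  then show ?thesis
    using \<open>1 \<le> c\<close> by (simp add: field_simps)
qed

text \<open>Trades an arbitrarily large factor outside \<open>f\<close> for one inside.\<close>

lemma doubling_iterate:
  fixes f :: "real \<Rightarrow> real"
  assumes "\<And>s. 0 \<le> s \<Longrightarrow> 2 * f s \<le> f (K * s)" and "0 \<le> K" "0 \<le> s"
  shows "2 ^ k * f s \<le> f (K ^ k * s)"
proof (induction k)
  case (Suc k)
  have "2 ^ Suc k * f s \<le> 2 * f (K ^ k * s)" using Suc by simp
  also have "\<dots> \<le> f (K * (K ^ k * s))" using assms by simp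
  finally show ?case by (simp add: mult.assoc)
qed simp

text \<open>The assumptions are asymmetric so that \<open>p\<close> may be the constant
  \<open>1\<close>: \<open>q\<close> makes the geometric mean vanish at \<open>0\<close> and
  increase strictly, and doubling, which is \<open>\<Delta>\<^sub>2\<close> read through the
  inverse, is asked of the mean only.\<close>

locale concave_pair =
  fixes p q :: "real \<Rightarrow> real" and \<theta> :: real
  assumes theta: "0 < \<theta>" "\<theta> < 1"
    and p_concave: "concave_on {0..} p" and q_concave: "concave_on {0..} q"
    and p_nonneg: "0 \<le> s \<Longrightarrow> 0 \<le> p s"
    and p_pos: "0 < s \<Longrightarrow> 0 < p s"
    and p_mono: "0 \<le> s \<Longrightarrow> s \<le> t \<Longrightarrow> p s \<le> p t"
    and q_zero: "q 0 = 0"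
    and q_strict: "0 \<le> s \<Longrightarrow> s < t \<Longrightarrow> q s < q t"
    and doubling: "\<exists>K\<ge>1. \<forall>s\<ge>0.
      2 * (p s powr (1 - \<theta>) * q s powr \<theta>) \<le> p (K * s) powr (1 - \<theta>) * q (K * s) powr \<theta>"
begin

section \<open>The geometric mean as a bijection of the half-line, and its inverse\<close>

definition w :: "real \<Rightarrow> real" where "w s = p s powr (1 - \<theta>) * q s powr \<theta>"

abbreviation \<phi> :: "complex \<Rightarrow> real" where "\<phi> \<equiv> phi_theta p q \<theta>"

lemma q_pos: "0 < s \<Longrightarrow> 0 < q s"
  using q_strict[of 0 s] q_zero by simp

lemma q_mono: "0 \<le> s \<Longrightarrow> s \<le> t \<Longrightarrow> q s \<le> q t"
  using q_strict[of s t] by (cases "s = t") auto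

lemma q_nonneg: "0 \<le> s \<Longrightarrow> 0 \<le> q s"
  using q_mono[of 0 s] q_zero by simp

lemmas p_subhomogeneous = concave_subhomogeneous[OF p_concave p_nonneg[OF order_refl]]
lemmas q_subhomogeneous = concave_subhomogeneous[OF q_concave q_nonneg[OF order_refl]]

lemma w_zero: "w 0 = 0"
  using q_zero by (simp add: w_def)

lemma w_pos: "0 < s \<Longrightarrow> 0 < w s"
  using p_pos[of s] q_pos[of s] by (auto simp: w_def intro!: mult_pos_pos)

lemma w_strict:
  assumes "0 \<le> s" "s < t"
  shows "w s < w t"
proof -
  have "p s powr (1 - \<theta>) * q s powr \<theta> \<le> p t powr (1 - \<theta>) * q s powr \<theta>"
    using assms theta by (intro mult_right_mono powr_mono2 p_mono) (auto simp: p_nonneg)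
  also have "\<dots> < p t powr (1 - \<theta>) * q t powr \<theta>"
    using assms theta p_pos[of t] q_nonneg[of s]
    by (intro mult_strict_left_mono powr_less_mono2 q_strict) auto
  finally show ?thesis by (simp add: w_def)
qed

lemma w_mono: "0 \<le> s \<Longrightarrow> s \<le> t \<Longrightarrow> w s \<le> w t"
  using w_strict[of s t] by (cases "s = t") auto

lemma w_less_cancel: "0 \<le> t \<Longrightarrow> w s \<le> w t \<Longrightarrow> s \<le> t"
  using w_strict[of t s] by force

lemma w_nonneg: "0 \<le> s \<Longrightarrow> 0 \<le> w s"
  using w_mono[of 0 s] w_zero by simp

lemma w_growth: "\<exists>C\<ge>1. \<forall>s\<ge>0. A * w s \<le> w (C * s)"
proof -
  obtain K where K: "1 \<le> K" "\<And>s. 0 \<le> s \<Longrightarrow> 2 * w s \<le> w (K * s)"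
    using doubling by (auto simp: w_def)
  obtain k where k: "A < 2 ^ k"
    using real_arch_pow[of 2 A] by auto
  have "A * w s \<le> w (K ^ k * s)" if "0 \<le> s" for s
    using doubling_iterate[of w K s k, OF K(2) _ that] K(1) mult_right_mono[OF less_imp_le[OF k] w_nonneg[OF that]] by linarith
  then show ?thesis using K(1) by (intro exI[of _ "K ^ k"]) (auto simp: one_le_power)
qed

lemma w_continuous: "continuous_on {0<..} w"
proof -
  have cont: "continuous_on {0<..} f" if "concave_on {0..} f" for f :: "real \<Rightarrow> real"
  proof -
    have "convex_on {0<..} (\<lambda>x. - f x)"
      using that unfolding concave_on_def by (rule convex_on_subset) auto
    then have "continuous_on {0<..} (\<lambda>x. - f x)"
      by (intro convex_on_continuous) auto
    then show ?thesis
      using continuous_on_minus by fastforce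
  qed
  have "p s \<noteq> 0" "q s \<noteq> 0" if "s \<in> {0<..}" for s
    using p_pos[of s] q_pos[of s] that by auto
  then show ?thesis
    unfolding w_def using cont[OF p_concave] cont[OF q_concave] by (intro continuous_intros) auto
qed

text \<open>The growth of \<open>w\<close> yields one point with value at least \<open>y\<close> and
  one with value at most \<open>y\<close>. Both are positive, so the intermediate value theorem
  needs continuity only away from \<open>0\<close>.\<close>

lemma w_surj:
  assumes "0 \<le> y"
  shows "y \<in> w ` {0..}"
proof (cases "y = 0")
  case True
  then show ?thesis using w_zero by (auto intro!: image_eqI[of _ _ 0])
next
  case False
  with assms have "0 < y" by simp
  have "0 < w 1" using w_pos by simp
  obtain C where C: "1 \<le> C" "\<And>s. 0 \<le> s \<Longrightarrow> y / w 1 * w s \<le> w (C * s)"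
    using w_growth by blast
  \<comment> \<open>Used at \<open>s = 1 / D\<close>, where it bounds \<open>w (1 / D)\<close> from
    above by \<open>y\<close>.\<close>
  obtain D where D: "1 \<le> D" "\<And>s. 0 \<le> s \<Longrightarrow> w 1 / y * w s \<le> w (D * s)"
    using w_growth by blast
  have "y \<le> w C" using C(2)[of 1] \<open>0 < w 1\<close> by simp
  have "w 1 / y * w (1 / D) \<le> w 1" using D(2)[of "1 / D"] D(1) by simp
  then have "w (1 / D) \<le> y" using \<open>0 < w 1\<close> \<open>0 < y\<close> by (simp add: field_simps)
  have "1 / D \<le> C" using C(1) D(1) by (meson divide_le_eq_1_pos less_le_trans order_trans zero_less_one)
  have D_pos: "0 < 1 / D" using D(1) by simp
  have "{1 / D..C} \<subseteq> {0<..}" using less_le_trans[OF D_pos] by auto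
  from continuous_on_subset[OF w_continuous this] obtain x where x: "1 / D \<le> x" "w x = y"
    using IVT'[OF \<open>w (1 / D) \<le> y\<close> \<open>y \<le> w C\<close> \<open>1 / D \<le> C\<close>] by blast
  have "0 \<le> x" using D_pos x(1) by linarith
  then have "x \<in> {0..}" by simp
  with x(2) show ?thesis by blast
qed

lemma w_inj: "inj_on w {0..}"
  by (intro linorder_inj_onI') (use w_strict in force)

lemma phi_eq: "\<phi> x = the_inv_into {0..} w (cmod x)"
  by (simp add: phi_theta_def w_def[abs_def])

lemma phi_nonneg: "0 \<le> \<phi> x"
  using the_inv_into_into[OF w_inj w_surj order_refl, of "cmod x"] by (simp add: phi_eq)

lemma w_phi: "w (\<phi> x) = cmod x"
  using f_the_inv_into_f[OF w_inj w_surj, of "cmod x"] by (simp add: phi_eq)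

lemma phi_cong_norm: "cmod x = cmod y \<Longrightarrow> \<phi> x = \<phi> y"
  by (simp add: phi_eq)

lemma phi_zero: "\<phi> 0 = 0"
  using the_inv_into_f_f[OF w_inj, of 0] w_zero by (simp add: phi_eq)

lemma phi_pos: "x \<noteq> 0 \<Longrightarrow> 0 < \<phi> x"
  using w_phi[of x] w_zero phi_nonneg[of x] by (cases "\<phi> x = 0") auto

text \<open>The working form of \<open>\<Delta>\<^sub>2\<close> for \<open>\<phi>\<close>: a factor
  \<open>A\<close> on the scale of \<open>w\<close> becomes a factor \<open>C\<close> on the scale
  of its argument, uniformly in \<open>x\<close> and \<open>s\<close>.\<close>

lemma phi_le:
  obtains C where "1 \<le> C" "\<And>x s. 0 \<le> s \<Longrightarrow> cmod x \<le> A * w s \<Longrightarrow> \<phi> x \<le> C * s"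
proof -
  obtain C where C: "1 \<le> C" "\<And>s. 0 \<le> s \<Longrightarrow> A * w s \<le> w (C * s)"
    using w_growth by blast
  have "\<phi> x \<le> C * s" if "0 \<le> s" "cmod x \<le> A * w s" for x s
  proof (rule w_less_cancel)
    show "0 \<le> C * s" using C(1) that(1) by simp
    show "w (\<phi> x) \<le> w (C * s)" unfolding w_phi using C(2)[OF that(1)] that(2) by linarith
  qed
  with C(1) show ?thesis by (rule that)
qed

lemma phi_filterlim:
  assumes "x \<noteq> 0"
  shows "filterlim (\<lambda>t::real. \<phi> (of_real t * x)) at_top at_top"
  unfolding filterlim_at_top
proof
  fix Z :: real
  \<comment> \<open>The truncation \<open>max 0 Z\<close> keeps the argument in the half-line, where
    \<open>w\<close> is known to be monotone.\<close>
  have "eventually (\<lambda>t. t \<ge> max 0 (w (max 0 Z) / cmod x)) at_top"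
    by (rule eventually_ge_at_top)
  then show "eventually (\<lambda>t. Z \<le> \<phi> (of_real t * x)) at_top"
  proof eventually_elim
    case (elim t)
    then have "w (max 0 Z) \<le> w (\<phi> (of_real t * x))"
      using assms by (simp add: w_phi norm_mult field_simps)
    then show ?case using w_less_cancel[OF phi_nonneg] by fastforce
  qed
qed

section \<open>The functions \<open>g_one\<close> on the strip\<close>

lemma g_one_eq: "g_one p q \<theta> x z = of_real (p (\<phi> x)) powr (1 - z) * of_real (q (\<phi> x)) powr z * sgn x"
  by (simp add: g_one_def phi_cong_norm[of "of_real (cmod x)" x])

lemma g_one_zero: "g_one p q \<theta> 0 z = 0"
  by (simp add: g_one_def)

lemma g_one_rotate:
  assumes "cmod c = 1"
  shows "g_one p q \<theta> (c * x) z = c * g_one p q \<theta> x z"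
  using assms phi_cong_norm[of "c * x" x] by (simp add: g_one_eq norm_mult sgn_eq)

lemma bounded_holomorphic_strip_g_one: "bounded_holomorphic_strip (g_one p q \<theta> x)"
proof (cases "x = 0")
  case True
  then show ?thesis by (simp add: g_one_zero[abs_def] bounded_holomorphic_strip_const)
next
  case False
  then have "0 < p (\<phi> x)" "0 < q (\<phi> x)" using phi_pos p_pos q_pos by auto
  then show ?thesis
    unfolding g_one_eq[abs_def]
    by (intro bounded_holomorphic_strip_mult[OF bounded_holomorphic_strip_powr] bounded_holomorphic_strip_const)
qed

lemma norm_g_one:
  assumes "x \<noteq> 0"
  shows "cmod (g_one p q \<theta> x z) = p (\<phi> x) powr (1 - Re z) * q (\<phi> x) powr Re z"
  using assms norm_powr_mix[of "p (\<phi> x)" "q (\<phi> x)" z] phi_pos[of x] p_pos[of "\<phi> x"] q_pos[of "\<phi> x"]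
  by (simp add: g_one_eq norm_mult norm_sgn)

text \<open>Equality holds for nonzero \<open>x\<close>; at \<open>x = 0\<close> the left side is
  \<open>0\<close> while \<open>p 0\<close> may be positive.\<close>

lemma norm_g_one_left: "Re z = 0 \<Longrightarrow> cmod (g_one p q \<theta> x z) \<le> p (\<phi> x)"
  using norm_g_one[of x z] phi_pos[of x] p_pos[of "\<phi> x"] q_pos[of "\<phi> x"] p_nonneg[of 0]
  by (cases "x = 0") (simp_all add: g_one_zero phi_zero)

lemma norm_g_one_right: "Re z = 1 \<Longrightarrow> cmod (g_one p q \<theta> x z) \<le> q (\<phi> x)"
  using norm_g_one[of x z] phi_pos[of x] p_pos[of "\<phi> x"] q_pos[of "\<phi> x"] q_zero
  by (cases "x = 0") (simp_all add: g_one_zero phi_zero)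

text \<open>At \<theta> the two powers combine to \<open>w (\<phi> x) = cmod x\<close>, and
  \<open>sgn x\<close> restores the phase.\<close>

lemma g_one_at_theta: "g_one p q \<theta> x (of_real \<theta>) = x"
proof -
  have "of_real (p (\<phi> x)) powr (1 - of_real \<theta>) * of_real (q (\<phi> x)) powr of_real \<theta> = complex_of_real (w (\<phi> x))"
    unfolding w_def of_real_mult using p_nonneg[OF phi_nonneg[of x]] q_nonneg[OF phi_nonneg[of x]]
    by (intro arg_cong2[where f = "(*)"]) (simp_all flip: powr_of_real)
  then show ?thesis
    by (simp add: g_one_eq w_phi sgn_eq)
qed

lemma theta_interior: "complex_of_real \<theta> \<in> interior strip"
  using theta by (simp add: interior_strip)

end

subsection \<open>The functions on \<open>\<complex>\<^sup>n\<close>\<close>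

text \<open>The zero of \<open>\<psi>\<close> at \<theta> is simple, so \<open>\<psi> z ^ m\<close>
  vanishes there to order exactly \<open>m\<close>.\<close>

locale concave_pair_disc = concave_pair +
  fixes \<psi> :: "complex \<Rightarrow> complex"
  assumes psi_strip: "bounded_holomorphic_strip \<psi>"
    and psi_le: "z \<in> strip \<Longrightarrow> cmod (\<psi> z) \<le> 1"
    and psi_theta: "\<psi> (of_real \<theta>) = 0"
    and deriv_psi: "deriv \<psi> (of_real \<theta>) \<noteq> 0"
begin

abbreviation G :: "nat \<Rightarrow> (nat \<Rightarrow> complex) \<Rightarrow> complex \<Rightarrow> complex" where
  "G \<equiv> g_vec p q \<theta> \<psi>"

abbreviation \<Phi> :: "nat \<Rightarrow> (nat \<Rightarrow> complex) \<Rightarrow> real" where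
  "\<Phi> \<equiv> phi_theta_n p q \<theta> \<psi>"

text \<open>The argument of \<open>\<phi>\<close> in the summand that leads from dimension
  \<open>m\<close> to \<open>m + 1\<close>. It also makes sense for \<open>m = 0\<close>, where it
  is \<open>x 0\<close> because \<open>G 0 x\<close> vanishes.\<close>

definition defect :: "nat \<Rightarrow> (nat \<Rightarrow> complex) \<Rightarrow> complex" where
  "defect m x = x m - taylor_coeff (G m x) m (of_real \<theta>)"

text \<open>In dimension 1 the factorial and \<open>k_const\<close> both equal \<open>1\<close>, so
  the recursion already holds from dimension 0 and inductions can start at a trivial case.\<close>

lemma G_Suc:
  "G (Suc m) x z = G m x z + \<psi> z ^ m / k_const \<psi> \<theta> (Suc m) * g_one p q \<theta> (fact (Suc m) * defect m x) z"
  by (cases m) (simp_all add: defect_def k_const_def numeral_2_eq_2)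

lemma Phi_Suc: "\<Phi> (Suc m) x = \<Phi> m x + \<phi> (defect m x)"
  by (cases m) (simp_all add: defect_def)

lemma Phi_nonneg: "0 \<le> \<Phi> m x"
  by (induction m) (simp_all add: Phi_Suc phi_nonneg)

lemma Phi_mono: "m \<le> n \<Longrightarrow> \<Phi> m x \<le> \<Phi> n x"
  by (induction n rule: dec_induct) (auto simp: Phi_Suc intro: add_increasing2 phi_nonneg)

lemma bounded_holomorphic_strip_G: "bounded_holomorphic_strip (G m x)"
proof (induction m)
  case 0
  then show ?case by (simp add: bounded_holomorphic_strip_const)
next
  case (Suc m)
  have "bounded_holomorphic_strip
      (\<lambda>z. \<psi> z ^ m * (1 / k_const \<psi> \<theta> (Suc m)) * g_one p q \<theta> (fact (Suc m) * defect m x) z)"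
    by (intro bounded_holomorphic_strip_mult bounded_holomorphic_strip_power psi_strip
        bounded_holomorphic_strip_const bounded_holomorphic_strip_g_one)
  from bounded_holomorphic_strip_add[OF Suc this] show ?case
    by (simp add: G_Suc[abs_def])
qed

text \<open>The summand added in dimension \<open>m + 1\<close> vanishes to order \<open>m\<close>
  at \<theta>, so it preserves the earlier coefficients; \<open>k_const\<close> and the factorial
  normalise its \<open>m\<close>-th coefficient to the defect.\<close>

lemma taylor_coeff_G: "j < n \<Longrightarrow> taylor_coeff (G n x) j (of_real \<theta>) = x j"
proof (induction n)
  case (Suc m)
  define k where "k = k_const \<psi> \<theta> (Suc m)"
  define g where "g = (\<lambda>z. 1 / k * g_one p q \<theta> (fact (Suc m) * defect m x) z)"
  have g: "bounded_holomorphic_strip g"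
    unfolding g_def by (intro bounded_holomorphic_strip_mult bounded_holomorphic_strip_const bounded_holomorphic_strip_g_one)
  have psim: "bounded_holomorphic_strip (\<lambda>z. \<psi> z ^ m)"
    by (intro bounded_holomorphic_strip_power psi_strip)
  have psi: "\<psi> holomorphic_on interior strip" using psi_strip by (simp add: bounded_holomorphic_strip_def)
  have zero: "(deriv ^^ i) (\<lambda>z. \<psi> z ^ m) (of_real \<theta>) = 0" if "i < m" for i
    using higher_deriv_power_at_zero(1)[OF psi open_interior theta_interior psi_theta that] .
  note low = higher_deriv_mult_lowest[of "\<lambda>z. \<psi> z ^ m" "interior strip" g, OF _ _ open_interior theta_interior zero]
  have GS: "G (Suc m) x = (\<lambda>z. G m x z + \<psi> z ^ m * g z)"
    by (simp add: G_Suc[abs_def] g_def k_def)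
  have eq: "taylor_coeff (G (Suc m) x) j (of_real \<theta>)
      = taylor_coeff (G m x) j (of_real \<theta>) + taylor_coeff (\<lambda>z. \<psi> z ^ m * g z) j (of_real \<theta>)"
    unfolding GS
    by (intro taylor_coeff_add bounded_holomorphic_strip_G bounded_holomorphic_strip_mult psim g theta_interior)
  show ?case
  proof (cases "j < m")
    case True
    then have "taylor_coeff (\<lambda>z. \<psi> z ^ m * g z) j (of_real \<theta>) = 0"
      using low(1)[of m j] psim g by (simp add: taylor_coeff_def bounded_holomorphic_strip_def)
    then show ?thesis using eq Suc.IH True by simp
  next
    case False
    then have j: "j = m" using Suc.prems by simp
    have "taylor_coeff (\<lambda>z. \<psi> z ^ m * g z) m (of_real \<theta>) = deriv \<psi> (of_real \<theta>) ^ m * g (of_real \<theta>)"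
      using low(2)[of m] psim g higher_deriv_power_at_zero(2)[OF psi open_interior theta_interior psi_theta, of m]
      by (simp add: taylor_coeff_def bounded_holomorphic_strip_def)
    also have "\<dots> = defect m x"
      using deriv_psi by (simp add: g_def k_def k_const_def g_one_at_theta del: fact_Suc)
    finally show ?thesis using eq by (simp add: j defect_def)
  qed
qed simp

text \<open>The constant is uniform in \<open>x\<close>. In the induction the factorial inside
  \<open>g_one\<close> costs a constant factor inside \<open>p\<close> and \<open>q\<close> by
  \<open>\<Delta>\<^sub>2\<close>, and subhomogeneity moves that factor outside.\<close>

lemma norm_G_le:
  obtains B where "0 < B"
    "\<And>x z. Re z = 0 \<Longrightarrow> cmod (G n x z) \<le> B * p (\<Phi> n x)"
    "\<And>x z. Re z = 1 \<Longrightarrow> cmod (G n x z) \<le> B * q (\<Phi> n x)"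
proof -
  have "\<exists>B>0. \<forall>x z. (Re z = 0 \<longrightarrow> cmod (G n x z) \<le> B * p (\<Phi> n x)) \<and>
      (Re z = 1 \<longrightarrow> cmod (G n x z) \<le> B * q (\<Phi> n x))"
  proof (induction n)
    case 0
    then show ?case using p_nonneg[of 0] q_zero by (intro exI[of _ 1]) simp
  next
    case (Suc m)
    then obtain B where B: "0 < B" "\<And>x z. Re z = 0 \<Longrightarrow> cmod (G m x z) \<le> B * p (\<Phi> m x)"
      "\<And>x z. Re z = 1 \<Longrightarrow> cmod (G m x z) \<le> B * q (\<Phi> m x)"
      by blast
    define k where "k = k_const \<psi> \<theta> (Suc m)"
    have "k \<noteq> 0" using deriv_psi by (simp add: k_def k_const_def del: fact_Suc)
    obtain C where C: "1 \<le> C" "\<And>x s. 0 \<le> s \<Longrightarrow> cmod x \<le> fact (Suc m) * w s \<Longrightarrow> \<phi> x \<le> C * s"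
      using phi_le by blast
    \<comment> \<open>Here \<open>v\<close> stands for \<open>p\<close> on the left line and for
      \<open>q\<close> on the right one.\<close>
    have step: "cmod (G (Suc m) x z) \<le> (B + C / cmod k) * v (\<Phi> (Suc m) x)"
      if "z \<in> strip" "cmod (G m x z) \<le> B * v (\<Phi> m x)"
        "\<And>y. cmod (g_one p q \<theta> y z) \<le> v (\<phi> y)"
        and mono: "\<And>s t. 0 \<le> s \<Longrightarrow> s \<le> t \<Longrightarrow> v s \<le> v t"
        and sub: "\<And>s. 0 \<le> s \<Longrightarrow> v (C * s) \<le> C * v s"
      for x z v
    proof -
      let ?d = "fact (Suc m) * defect m x"
      have "\<phi> ?d \<le> C * \<phi> (defect m x)"
        by (intro C) (simp_all add: phi_nonneg w_phi norm_mult del: fact_Suc)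
      also have "\<dots> \<le> C * \<Phi> (Suc m) x"
        using C(1) Phi_nonneg[of m x] by (simp add: Phi_Suc)
      finally have "v (\<phi> ?d) \<le> v (C * \<Phi> (Suc m) x)"
        by (intro mono phi_nonneg)
      then have d: "cmod (g_one p q \<theta> ?d z) \<le> C * v (\<Phi> (Suc m) x)"
        using that(3)[of ?d] sub[OF Phi_nonneg[of "Suc m" x]] by linarith
      have "cmod (G (Suc m) x z) \<le> cmod (G m x z) + cmod (\<psi> z) ^ m * (cmod (g_one p q \<theta> ?d z) / cmod k)"
        unfolding G_Suc k_def[symmetric]
        by (rule order_trans[OF norm_triangle_ineq]) (simp add: norm_mult norm_divide norm_power)
      also have "\<dots> \<le> B * v (\<Phi> (Suc m) x) + 1 * (C * v (\<Phi> (Suc m) x) / cmod k)"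
      proof (intro add_mono mult_mono divide_right_mono d)
        have "B * v (\<Phi> m x) \<le> B * v (\<Phi> (Suc m) x)"
          using B(1) by (intro mult_left_mono mono Phi_nonneg Phi_mono) auto
        then show "cmod (G m x z) \<le> B * v (\<Phi> (Suc m) x)" using that(2) by linarith
        show "cmod (\<psi> z) ^ m \<le> 1" using psi_le[OF that(1)] by (intro power_le_one) auto
      qed auto
      finally show ?thesis by (simp add: algebra_simps)
    qed
    have "cmod (G (Suc m) x z) \<le> (B + C / cmod k) * p (\<Phi> (Suc m) x)" if "Re z = 0" for x z
      using that C(1) by (intro step B norm_g_one_left p_mono p_subhomogeneous) (auto simp: strip_def)
    moreover have "cmod (G (Suc m) x z) \<le> (B + C / cmod k) * q (\<Phi> (Suc m) x)" if "Re z = 1" for x z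
      using that C(1) by (intro step B norm_g_one_right q_mono q_subhomogeneous) (auto simp: strip_def)
    moreover have "0 < B + C / cmod k" using B(1) C(1) by (simp add: add_pos_nonneg)
    ultimately show ?case by blast
  qed
  then show ?thesis using that by blast
qed

text \<open>A converse to \<open>norm_G_le\<close>, with \<open>C\<close> chosen before
  \<open>f\<close>, \<open>R\<close> and \<open>x\<close>. Requiring \<open>R > 0\<close> keeps
  \<open>p R\<close> and \<open>q R\<close> positive, so that the reciprocal weight exists.\<close>

lemma Phi_le:
  assumes "0 < A"
  obtains C where "1 \<le> C"
    "\<And>f R x. bounded_holomorphic_strip f \<Longrightarrow> 0 < R \<Longrightarrow>
       (\<And>z. Re z = 0 \<Longrightarrow> cmod (f z) \<le> A * p R) \<Longrightarrow>
       (\<And>z. Re z = 1 \<Longrightarrow> cmod (f z) \<le> A * q R) \<Longrightarrow>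
       (\<And>j. j < n \<Longrightarrow> taylor_coeff f j (of_real \<theta>) = x j) \<Longrightarrow> \<Phi> n x \<le> C * R"
proof -
  have "\<exists>C\<ge>1. \<forall>f R x. bounded_holomorphic_strip f \<longrightarrow> 0 < R \<longrightarrow>
      (\<forall>z. Re z = 0 \<longrightarrow> cmod (f z) \<le> A * p R) \<longrightarrow> (\<forall>z. Re z = 1 \<longrightarrow> cmod (f z) \<le> A * q R) \<longrightarrow>
      (\<forall>j<n. taylor_coeff f j (of_real \<theta>) = x j) \<longrightarrow> \<Phi> n x \<le> C * R"
  proof (induction n)
    case 0
    then show ?case by (intro exI[of _ 1]) auto
  next
    case (Suc m)
    then obtain C where C: "1 \<le> C" "\<And>f R x. bounded_holomorphic_strip f \<Longrightarrow> 0 < R \<Longrightarrow>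
      (\<forall>z. Re z = 0 \<longrightarrow> cmod (f z) \<le> A * p R) \<Longrightarrow> (\<forall>z. Re z = 1 \<longrightarrow> cmod (f z) \<le> A * q R) \<Longrightarrow>
      (\<forall>j<m. taylor_coeff f j (of_real \<theta>) = x j) \<Longrightarrow> \<Phi> m x \<le> C * R"
      by blast
    obtain B where B: "0 < B" "\<And>x z. Re z = 0 \<Longrightarrow> cmod (G m x z) \<le> B * p (\<Phi> m x)"
      "\<And>x z. Re z = 1 \<Longrightarrow> cmod (G m x z) \<le> B * q (\<Phi> m x)"
      using norm_G_le by blast
    \<comment> \<open>The part \<open>A\<close> bounds \<open>f\<close>. The part
      \<open>B * C\<close> bounds \<open>G m x\<close>, since \<open>\<Phi> m x \<le> C * R\<close>
      by induction and \<open>C\<close> can be pulled out of \<open>p\<close> and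
      \<open>q\<close>.\<close>
    define D where "D = A + B * C"
    have "0 < D" using assms B(1) C(1) by (simp add: D_def add_pos_nonneg)
    \<comment> \<open>The factor of \<open>w s\<close> is the one from Cauchy's estimate;
      \<open>K\<close> turns that estimate of the defect into a multiple of
      \<open>R\<close>.\<close>
    obtain K where K: "1 \<le> K"
      "\<And>x s. 0 \<le> s \<Longrightarrow> cmod x \<le> D / min \<theta> (1 - \<theta>) ^ m * w s \<Longrightarrow> \<phi> x \<le> K * s"
      using phi_le by blast
    have "\<Phi> (Suc m) x \<le> (C + K) * R"
      if f: "bounded_holomorphic_strip f" and "0 < R"
        and f0: "\<forall>z. Re z = 0 \<longrightarrow> cmod (f z) \<le> A * p R"
        and f1: "\<forall>z. Re z = 1 \<longrightarrow> cmod (f z) \<le> A * q R"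
        and coeff: "\<forall>j<Suc m. taylor_coeff f j (of_real \<theta>) = x j" for f R x
    proof -
      have IH: "\<Phi> m x \<le> C * R"
        using C(2)[OF f \<open>0 < R\<close> f0 f1] coeff by simp
      let ?F = "\<lambda>z. f z - G m x z"
      have F: "bounded_holomorphic_strip ?F"
        by (intro bounded_holomorphic_strip_diff f bounded_holomorphic_strip_G)
      have bd: "cmod (?F z) \<le> D * v R"
        if "cmod (f z) \<le> A * v R" "cmod (G m x z) \<le> B * v (\<Phi> m x)"
          "v (\<Phi> m x) \<le> v (C * R)" "v (C * R) \<le> C * v R" for z v
      proof -
        have "B * v (\<Phi> m x) \<le> B * (C * v R)"
          using that(3,4) B(1) by (intro mult_left_mono) auto
        then show ?thesis
          using norm_triangle_ineq4[of "f z" "G m x z"] that(1,2) by (simp add: D_def algebra_simps)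
      qed
      have Fc: "taylor_coeff ?F j (of_real \<theta>) = x j - taylor_coeff (G m x) j (of_real \<theta>)" if "j < Suc m" for j
        using taylor_coeff_diff[OF f bounded_holomorphic_strip_G theta_interior] coeff that by simp
      have "cmod (taylor_coeff ?F m (of_real \<theta>))
          \<le> D / min \<theta> (1 - \<theta>) ^ m * (p R powr (1 - \<theta>) * q R powr \<theta>)"
      proof (rule lowest_taylor_coeff_le[OF F])
        show "cmod (?F z) \<le> D * p R" if "Re z = 0" for z
          using that f0 C(1) \<open>0 < R\<close> IH
          by (intro bd[of z p] B p_mono p_subhomogeneous) (auto simp: Phi_nonneg)
        show "cmod (?F z) \<le> D * q R" if "Re z = 1" for z
          using that f1 C(1) \<open>0 < R\<close> IH
          by (intro bd[of z q] B q_mono q_subhomogeneous) (auto simp: Phi_nonneg)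
        show "(deriv ^^ j) ?F (of_real \<theta>) = 0" if "j < m" for j
          using Fc[of j] taylor_coeff_G[OF that, of x] that by (simp add: taylor_coeff_def)
      qed (use \<open>0 < D\<close> \<open>0 < R\<close> p_pos q_pos theta in auto)
      \<comment> \<open>Since \<open>f\<close> has \<open>m\<close>-th coefficient
        \<open>x m\<close>, the \<open>m\<close>-th coefficient of \<open>?F\<close> is the
        defect.\<close>
      then have "cmod (defect m x) \<le> D / min \<theta> (1 - \<theta>) ^ m * w R"
        by (simp add: Fc defect_def w_def)
      then have "\<phi> (defect m x) \<le> K * R"
        using \<open>0 < R\<close> by (intro K) auto
      then show ?thesis using IH by (simp add: Phi_Suc algebra_simps)
    qed
    moreover have "1 \<le> C + K" using C(1) K(1) by simp
    ultimately show ?case by blast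
  qed
  then show ?thesis using that by blast
qed

text \<open>The convex combination of \<open>G n x\<close> and \<open>G n y\<close> has the right
  Taylor coefficients, although it generally differs from \<open>G n\<close> of the combined vector;
  \<open>Phi_le\<close> compares the two.\<close>

lemma Phi_quasi_convex:
  "\<exists>C>0. \<forall>x y. \<forall>t\<in>{0..1}.
     \<Phi> n (\<lambda>i. of_real t * x i + of_real (1 - t) * y i) \<le> C * (t * \<Phi> n x + (1 - t) * \<Phi> n y)"
proof -
  obtain B where B: "0 < B" "\<And>x z. Re z = 0 \<Longrightarrow> cmod (G n x z) \<le> B * p (\<Phi> n x)"
    "\<And>x z. Re z = 1 \<Longrightarrow> cmod (G n x z) \<le> B * q (\<Phi> n x)"
    using norm_G_le by blast
  obtain C where C: "1 \<le> C"
    "\<And>f R x. bounded_holomorphic_strip f \<Longrightarrow> 0 < R \<Longrightarrow>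
       (\<And>z. Re z = 0 \<Longrightarrow> cmod (f z) \<le> B * p R) \<Longrightarrow>
       (\<And>z. Re z = 1 \<Longrightarrow> cmod (f z) \<le> B * q R) \<Longrightarrow>
       (\<And>j. j < n \<Longrightarrow> taylor_coeff f j (of_real \<theta>) = x j) \<Longrightarrow> \<Phi> n x \<le> C * R"
    using Phi_le[OF B(1)] by blast
  have "\<Phi> n (\<lambda>i. of_real t * x i + of_real (1 - t) * y i) \<le> C * (t * \<Phi> n x + (1 - t) * \<Phi> n y)"
    if t: "0 \<le> t" "t \<le> 1" for x y t
  proof -
    define R where "R = t * \<Phi> n x + (1 - t) * \<Phi> n y"
    have "0 \<le> R" using t Phi_nonneg by (simp add: R_def)
    let ?f = "\<lambda>z. of_real t * G n x z + of_real (1 - t) * G n y z"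
    have f: "bounded_holomorphic_strip ?f"
      by (intro bounded_holomorphic_strip_add bounded_holomorphic_strip_mult
          bounded_holomorphic_strip_const bounded_holomorphic_strip_G)
    have bd: "cmod (?f z) \<le> B * v S"
      if "cmod (G n x z) \<le> B * v (\<Phi> n x)" "cmod (G n y z) \<le> B * v (\<Phi> n y)"
        "concave_on {0..} v" "v R \<le> v S" for z v S
    proof -
      have "cmod (?f z) \<le> t * cmod (G n x z) + (1 - t) * cmod (G n y z)"
        using t by (intro order_trans[OF norm_triangle_ineq]) (simp add: norm_mult del: of_real_diff)
      also have "\<dots> \<le> t * (B * v (\<Phi> n x)) + (1 - t) * (B * v (\<Phi> n y))"
        using t that(1,2) by (intro add_mono mult_left_mono) auto
      also have "\<dots> = B * ((1 - t) * v (\<Phi> n y) + t * v (\<Phi> n x))"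
        by (simp add: algebra_simps)
      also have "\<dots> \<le> B * v R"
        using concave_onD[OF that(3) t, of "\<Phi> n y" "\<Phi> n x"] B(1)
        by (intro mult_left_mono) (auto simp: Phi_nonneg R_def add.commute)
      also have "\<dots> \<le> B * v S"
        using that(4) B(1) by (intro mult_left_mono) auto
      finally show ?thesis .
    qed
    have coeff: "taylor_coeff ?f j (of_real \<theta>) = of_real t * x j + of_real (1 - t) * y j" if "j < n" for j
      by (subst taylor_coeff_add)
         (simp_all add: taylor_coeff_cmult taylor_coeff_G that theta_interior bounded_holomorphic_strip_G
           bounded_holomorphic_strip_mult[OF bounded_holomorphic_strip_const] del: of_real_diff)
    \<comment> \<open>\<open>S > R\<close> because \<open>p R\<close> and \<open>q R\<close> may vanish when \<open>R = 0\<close>.\<close>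
    have le: "\<Phi> n (\<lambda>i. of_real t * x i + of_real (1 - t) * y i) \<le> C * S" if "R < S" for S
    proof (rule C(2)[OF f])
      show "cmod (?f z) \<le> B * p S" if "Re z = 0" for z
        using that \<open>R < S\<close> \<open>0 \<le> R\<close> by (intro bd[of z p] B p_concave p_mono) auto
      show "cmod (?f z) \<le> B * q S" if "Re z = 1" for z
        using that \<open>R < S\<close> \<open>0 \<le> R\<close> by (intro bd[of z q] B q_concave q_mono) auto
    qed (use that \<open>0 \<le> R\<close> coeff in auto)
    \<comment> \<open>Letting \<open>S\<close> decrease to \<open>R\<close>: the choice
      \<open>S = R + e / C\<close> costs exactly \<open>e\<close>.\<close>
    have "\<Phi> n (\<lambda>i. of_real t * x i + of_real (1 - t) * y i) \<le> C * R"
    proof (rule field_le_epsilon)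
      fix e :: real assume "0 < e"
      then show "\<Phi> n (\<lambda>i. of_real t * x i + of_real (1 - t) * y i) \<le> C * R + e"
        using le[of "R + e / C"] C(1) by (simp add: algebra_simps)
    qed
    then show ?thesis by (simp add: R_def)
  qed
  then show ?thesis using C(1) by (intro exI[of _ C]) auto
qed

lemma G_zero:
  assumes "\<And>i. i < m \<Longrightarrow> x i = 0"
  shows "G m x = (\<lambda>z. 0) \<and> \<Phi> m x = 0"
  using assms
proof (induction m)
  case (Suc m)
  then have "G m x = (\<lambda>z. 0)" "\<Phi> m x = 0" "defect m x = 0" by (auto simp: defect_def)
  then show ?case by (simp add: G_Suc[abs_def] Phi_Suc g_one_zero phi_zero)
qed simp

text \<open>Taylor coefficients are linear and \<open>g_one\<close> commutes with rotations, so the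
  defects rotate along with \<open>x\<close>, while \<open>\<phi>\<close> sees only their
  moduli.\<close>

lemma G_rotate:
  assumes "cmod c = 1"
  shows "G m (\<lambda>i. c * x i) = (\<lambda>z. c * G m x z) \<and> \<Phi> m (\<lambda>i. c * x i) = \<Phi> m x"
proof (induction m)
  case (Suc m)
  then have d: "defect m (\<lambda>i. c * x i) = c * defect m x"
    using taylor_coeff_cmult[OF bounded_holomorphic_strip_G theta_interior]
    by (simp add: defect_def algebra_simps)
  have "g_one p q \<theta> (fact (Suc m) * (c * defect m x)) z = c * g_one p q \<theta> (fact (Suc m) * defect m x) z" for z
    using g_one_rotate[OF assms, of "fact (Suc m) * defect m x" z] by (simp add: mult.left_commute)
  moreover have "\<phi> (c * defect m x) = \<phi> (defect m x)"
    using assms by (intro phi_cong_norm) (simp add: norm_mult)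
  ultimately show ?case
    using Suc d by (simp add: G_Suc[abs_def] Phi_Suc distrib_left mult.left_commute del: fact_Suc)
qed simp

text \<open>Defects are in general not linear in \<open>t\<close>, so a single summand is used: at
  the first nonzero entry \<open>x j\<close> the function \<open>G j\<close> still vanishes and the
  defect is exactly \<open>t * x j\<close>.\<close>

lemma Phi_filterlim:
  assumes x: "x \<in> Cn n" "x \<noteq> (\<lambda>_. 0)"
  shows "filterlim (\<lambda>t::real. \<Phi> n (\<lambda>i. of_real t * x i)) at_top at_top"
proof -
  define j where "j = (LEAST j. x j \<noteq> 0)"
  have ex: "\<exists>j. x j \<noteq> 0" using x(2) by auto
  then have xj: "x j \<noteq> 0" unfolding j_def by (rule LeastI_ex)
  have below: "x i = 0" if "i < j" for i
    using not_less_Least that unfolding j_def by blast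
  have "j < n" using x(1) xj by (force simp: Cn_def not_le[symmetric])
  have "\<phi> (of_real t * x j) \<le> \<Phi> n (\<lambda>i. of_real t * x i)" for t
  proof -
    have "G j (\<lambda>i. of_real t * x i) = (\<lambda>z. 0)" "\<Phi> j (\<lambda>i. of_real t * x i) = 0"
      using G_zero[of j "\<lambda>i. of_real t * x i"] below by auto
    then have "\<Phi> (Suc j) (\<lambda>i. of_real t * x i) = \<phi> (of_real t * x j)"
      by (simp add: Phi_Suc defect_def)
    then show ?thesis using Phi_mono[of "Suc j" n "\<lambda>i. of_real t * x i"] \<open>j < n\<close> by simp
  qed
  then show ?thesis
    by (intro filterlim_at_top_mono[OF phi_filterlim[OF xj]]) auto
qed

lemma quasi_young_Phi: "quasi_young n (\<Phi> n)"
  unfolding quasi_young_def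
proof (intro conjI ballI allI impI)
  show "0 \<le> \<Phi> n x" for x by (rule Phi_nonneg)
  show "\<Phi> n (\<lambda>_. 0) = 0" using G_zero[of n "\<lambda>_. 0"] by simp
  show "\<Phi> n (\<lambda>i. exp (\<i> * of_real s) * x i) = \<Phi> n x" for s x
    using G_rotate[of "exp (\<i> * of_real s)" n x] by simp
  show "\<exists>C>0. \<forall>x\<in>Cn n. \<forall>y\<in>Cn n. \<forall>t\<in>{0..1}.
      \<Phi> n (\<lambda>i. of_real t * x i + of_real (1 - t) * y i) \<le> C * (t * \<Phi> n x + (1 - t) * \<Phi> n y)"
    using Phi_quasi_convex[of n] by blast
qed (rule Phi_filterlim)

end

subsection \<open>Inverses of Orlicz functions\<close>

locale nondegenerate_orlicz =
  fixes \<phi> :: "complex \<Rightarrow> real"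
  assumes orlicz: "orlicz \<phi>" and nondegenerate: "nondegenerate \<phi>" and delta2: "delta2 \<phi>"
begin

definition r :: "real \<Rightarrow> real" where "r t = \<phi> (of_real t)"

lemma r_zero: "r 0 = 0"
  using orlicz by (simp add: orlicz_def r_def)

lemma r_pos: "0 < t \<Longrightarrow> 0 < r t"
  using nondegenerate by (simp add: nondegenerate_def r_def)

lemma r_convex: "0 \<le> u \<Longrightarrow> u \<le> 1 \<Longrightarrow> r ((1 - u) * s + u * t) \<le> (1 - u) * r s + u * r t"
proof -
  assume u: "0 \<le> u" "u \<le> 1"
  have "convex_on UNIV \<phi>" using orlicz by (simp add: orlicz_def)
  from convex_onD[OF this u, of "of_real s" "of_real t"] show ?thesis
    by (simp add: r_def scaleR_conv_of_real)
qed

text \<open>Convexity between \<open>0\<close> and \<open>t\<close> gives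
  \<open>r s \<le> s / t * r t\<close>, and nondegeneracy makes this strictly smaller than
  \<open>r t\<close>.\<close>

lemma r_strict:
  assumes "0 \<le> s" "s < t"
  shows "r s < r t"
proof -
  have "r ((1 - s / t) * 0 + s / t * t) \<le> (1 - s / t) * r 0 + s / t * r t"
    using assms by (intro r_convex) auto
  then have "r s \<le> s / t * r t" using assms by (simp add: r_zero)
  also have "\<dots> < 1 * r t"
    using assms r_pos[of t] by (intro mult_strict_right_mono) auto
  finally show ?thesis by simp
qed

lemma r_le_cancel: "0 \<le> t \<Longrightarrow> r s \<le> r t \<Longrightarrow> s \<le> t"
  using r_strict[of t s] by force

lemma r_inj: "inj_on r {0..}"
  by (intro linorder_inj_onI') (use r_strict in force)

text \<open>As \<open>r\<close> is convex on the whole real line, \<open>0\<close> is an interior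
  point and continuity holds there too.\<close>

lemma r_continuous: "continuous_on S r"
proof -
  have "convex_on UNIV r"
    using r_convex by (intro convex_onI) (auto simp: algebra_simps)
  then have "continuous_on UNIV r" by (intro convex_on_continuous) auto
  then show ?thesis by (rule continuous_on_subset) simp
qed

lemma r_surj:
  assumes "0 \<le> s"
  shows "s \<in> r ` {0..}"
proof -
  have "filterlim (\<lambda>t::real. \<phi> (of_real t * 1)) at_top at_top"
    using orlicz unfolding orlicz_def by (metis one_neq_zero)
  then have "filterlim r at_top at_top"
    by (simp add: r_def[abs_def])
  then have "eventually (\<lambda>t. s \<le> r t) at_top"
    by (simp add: filterlim_at_top)
  then have "eventually (\<lambda>t. s \<le> r t \<and> 0 \<le> t) at_top"
    using eventually_ge_at_top[of 0] by (rule eventually_conj)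
  from eventually_happens'[OF trivial_limit_at_top_linorder this]
  obtain T where "s \<le> r T" "0 \<le> T" by blast
  then obtain x where "0 \<le> x" "r x = s"
    using IVT'[of r 0 s T] assms r_zero r_continuous by auto
  then show ?thesis by auto
qed

abbreviation q :: "real \<Rightarrow> real" where "q \<equiv> orlicz_inv \<phi>"

lemma q_eq: "q = the_inv_into {0..} r"
  by (simp add: orlicz_inv_def r_def[abs_def])

lemma r_q: "0 \<le> s \<Longrightarrow> r (q s) = s"
  using f_the_inv_into_f[OF r_inj r_surj] by (simp add: q_eq)

lemma q_nonneg: "0 \<le> s \<Longrightarrow> 0 \<le> q s"
  using the_inv_into_into[OF r_inj r_surj order_refl] by (simp add: q_eq)

lemma q_zero: "q 0 = 0"
  using the_inv_into_f_f[OF r_inj, of 0] by (simp add: q_eq r_zero)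

text \<open>Turns upper bounds on \<open>r\<close> into lower bounds on \<open>q\<close>; concavity
  and doubling of \<open>q\<close> are obtained this way from convexity and
  \<open>\<Delta>\<^sub>2\<close>.\<close>

lemma q_ge:
  assumes "0 \<le> s" "r t \<le> s"
  shows "t \<le> q s"
  using assms r_le_cancel[OF q_nonneg[OF assms(1)]] by (simp add: r_q)

lemma q_strict:
  assumes "0 \<le> s" "s < t"
  shows "q s < q t"
proof -
  have "q s \<le> q t" using assms by (intro q_ge) (simp_all add: r_q)
  moreover have "q s \<noteq> q t" using r_q[of s] r_q[of t] assms by auto
  ultimately show ?thesis by simp
qed

lemma q_concave: "concave_on {0..} q"
  unfolding concave_on_iff
proof (intro conjI ballI allI impI)
  fix x y u v :: real
  assume xy: "x \<in> {0..}" "y \<in> {0..}" and uv: "0 \<le> u" "0 \<le> v" "u + v = 1"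
  have u: "u = 1 - v" using uv(3) by simp
  have "r (u * q x + v * q y) \<le> u * x + v * y"
    using r_convex[of v "q x" "q y"] uv xy by (simp add: r_q u)
  then show "u * q x + v * q y \<le> q (u *\<^sub>R x + v *\<^sub>R y)"
    using xy uv by (intro q_ge) auto
qed simp

lemma q_doubling:
  obtains M where "1 \<le> M" "\<And>s. 0 \<le> s \<Longrightarrow> 2 * q s \<le> q (M * s)"
proof -
  obtain M where M: "0 < M" "\<And>x. \<phi> (2 * x) \<le> M * \<phi> x"
    using delta2 by (auto simp: delta2_def)
  have "2 * q s \<le> q (max 1 M * s)" if "0 \<le> s" for s
  proof (rule q_ge)
    have "r (2 * q s) \<le> M * s"
      using M(2)[of "of_real (q s)"] r_q[OF that] by (simp add: r_def)
    also have "\<dots> \<le> max 1 M * s" using that by (intro mult_right_mono) auto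
    finally show "r (2 * q s) \<le> max 1 M * s" .
  qed (use that in auto)
  then show ?thesis using that[of "max 1 M"] by simp
qed

end

section \<open>The assumptions on the pair for each kind of left endpoint\<close>

lemma concave_pair_orlicz:
  assumes "0 < \<theta>" "\<theta> < 1" and "nondegenerate_orlicz \<phi>\<^sub>0" "nondegenerate_orlicz \<phi>\<^sub>1"
  shows "concave_pair (orlicz_inv \<phi>\<^sub>0) (orlicz_inv \<phi>\<^sub>1) \<theta>"
proof -
  interpret P: nondegenerate_orlicz \<phi>\<^sub>0 by fact
  interpret Q: nondegenerate_orlicz \<phi>\<^sub>1 by fact
  let ?p = "orlicz_inv \<phi>\<^sub>0" and ?q = "orlicz_inv \<phi>\<^sub>1"
  obtain M where M: "1 \<le> M" "\<And>s. 0 \<le> s \<Longrightarrow> 2 * ?p s \<le> ?p (M * s)" using P.q_doubling by blast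
  obtain N where N: "1 \<le> N" "\<And>s. 0 \<le> s \<Longrightarrow> 2 * ?q s \<le> ?q (N * s)" using Q.q_doubling by blast
  have mono: "?p s \<le> ?p t" "?q s \<le> ?q t" if "0 \<le> s" "s \<le> t" for s t
    using P.q_strict[of s t] Q.q_strict[of s t] that by (cases "s = t"; auto)+
  show ?thesis
  proof
    show "\<exists>K\<ge>1. \<forall>s\<ge>0. 2 * (?p s powr (1 - \<theta>) * ?q s powr \<theta>) \<le> ?p (K * s) powr (1 - \<theta>) * ?q (K * s) powr \<theta>"
    \<comment> \<open>The factor 2 is split as
      \<open>2 powr (1 - \<theta>) * 2 powr \<theta>\<close>, one part for each function;
      \<open>M * N\<close> dominates both doubling constants.\<close>
    proof (intro exI[of _ "M * N"] conjI allI impI)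
      show "1 \<le> M * N" using M(1) N(1) mult_mono[of 1 M 1 N] by simp
      fix s :: real assume "0 \<le> s"
      have le: "M * s \<le> M * N * s" "N * s \<le> M * N * s"
        using M(1) N(1) \<open>0 \<le> s\<close> mult_left_mono[of 1 N "M * s"] mult_left_mono[of 1 M "N * s"]
        by (auto simp: mult_ac)
      have "2 * (?p s powr (1 - \<theta>) * ?q s powr \<theta>)
          = (2 powr (1 - \<theta>) * 2 powr \<theta>) * (?p s powr (1 - \<theta>) * ?q s powr \<theta>)"
        by (simp flip: powr_add)
      also have "\<dots> = (2 * ?p s) powr (1 - \<theta>) * (2 * ?q s) powr \<theta>"
        using P.q_nonneg Q.q_nonneg \<open>0 \<le> s\<close> by (simp add: powr_mult mult_ac)
      also have "\<dots> \<le> ?p (M * N * s) powr (1 - \<theta>) * ?q (M * N * s) powr \<theta>"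
      proof (intro mult_mono powr_mono2)
        show "2 * ?p s \<le> ?p (M * N * s)"
          using M(2)[OF \<open>0 \<le> s\<close>] mono(1)[OF _ le(1)] M(1) \<open>0 \<le> s\<close> by fastforce
        show "2 * ?q s \<le> ?q (M * N * s)"
          using N(2)[OF \<open>0 \<le> s\<close>] mono(2)[OF _ le(2)] N(1) \<open>0 \<le> s\<close> by fastforce
      qed (use assms P.q_nonneg Q.q_nonneg \<open>0 \<le> s\<close> in auto)
      finally show "2 * (?p s powr (1 - \<theta>) * ?q s powr \<theta>)
          \<le> ?p (M * N * s) powr (1 - \<theta>) * ?q (M * N * s) powr \<theta>" .
    qed
    show "0 < ?p s" if "0 < s" for s using P.q_strict[of 0 s] P.q_zero that by simp
  qed (use assms P.q_concave Q.q_concave P.q_nonneg mono Q.q_zero Q.q_strict in auto)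
qed

lemma concave_pair_const_orlicz:
  assumes "0 < \<theta>" "\<theta> < 1" and "nondegenerate_orlicz \<phi>\<^sub>1"
  shows "concave_pair (\<lambda>_. 1) (orlicz_inv \<phi>\<^sub>1) \<theta>"
proof -
  interpret Q: nondegenerate_orlicz \<phi>\<^sub>1 by fact
  let ?q = "orlicz_inv \<phi>\<^sub>1"
  obtain N where N: "1 \<le> N" "\<And>s. 0 \<le> s \<Longrightarrow> 2 * ?q s \<le> ?q (N * s)" using Q.q_doubling by blast
  \<comment> \<open>Only \<open>q\<close> grows, and its power \<theta> weakens the factor 2 to
    \<open>2 powr \<theta>\<close>; doubling more than \<open>1 / \<theta>\<close> times recovers
    it.\<close>
  obtain k :: nat where k: "1 / \<theta> < k" using reals_Archimedean2 by blast
  show ?thesis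
  proof
    show "\<exists>K\<ge>1. \<forall>s\<ge>0. 2 * (1 powr (1 - \<theta>) * ?q s powr \<theta>) \<le> 1 powr (1 - \<theta>) * ?q (K * s) powr \<theta>"
    proof (intro exI[of _ "N ^ k"] conjI allI impI)
      show "1 \<le> N ^ k" using N(1) by (rule one_le_power)
      fix s :: real assume "0 \<le> s"
      have "(2::real) = 2 powr (1 / \<theta> * \<theta>)" using assms by simp
      also have "\<dots> \<le> 2 powr (k * \<theta>)"
        using k assms by (intro powr_mono mult_right_mono) auto
      also have "\<dots> = (2 ^ k) powr \<theta>" by (simp add: powr_powr flip: powr_realpow)
      finally have "2 * ?q s powr \<theta> \<le> (2 ^ k) powr \<theta> * ?q s powr \<theta>"
        by (intro mult_right_mono) auto
      also have "\<dots> = (2 ^ k * ?q s) powr \<theta>" using Q.q_nonneg[OF \<open>0 \<le> s\<close>] by (simp add: powr_mult)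
      also have "\<dots> \<le> ?q (N ^ k * s) powr \<theta>"
        using doubling_iterate[of ?q N s k, OF N(2) _ \<open>0 \<le> s\<close>] N(1) Q.q_nonneg[OF \<open>0 \<le> s\<close>] assms by (intro powr_mono2) auto
      finally show "2 * (1 powr (1 - \<theta>) * ?q s powr \<theta>) \<le> 1 powr (1 - \<theta>) * ?q (N ^ k * s) powr \<theta>"
        by simp
    qed
    show "concave_on {0::real..} (\<lambda>_. 1)" by (simp add: concave_on_iff)
  qed (use assms Q.q_concave Q.q_zero Q.q_strict in auto)
qed

theorem theorem3p4:
  fixes E\<^sub>0 :: left_endpoint and \<phi>\<^sub>1 :: "complex \<Rightarrow> real" and \<theta> :: real
    and \<psi> :: "complex \<Rightarrow> complex" and n :: nat
  assumes "left_admissible E\<^sub>0"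
    and "orlicz \<phi>\<^sub>1" and "nondegenerate \<phi>\<^sub>1" and "delta2 \<phi>\<^sub>1"
    and "0 < \<theta>" and "\<theta> < 1"
    and "conformal_strip_disc \<psi>" and "\<psi> (of_real \<theta>) = 0"
    and "1 \<le> n"
  shows "quasi_young n (phi_theta_n (left_inv E\<^sub>0) (orlicz_inv \<phi>\<^sub>1) \<theta> \<psi> n)"
proof -
  have \<phi>\<^sub>1: "nondegenerate_orlicz \<phi>\<^sub>1"
    using assms(2-4) by (simp add: nondegenerate_orlicz_def)
  have pair: "concave_pair (left_inv E\<^sub>0) (orlicz_inv \<phi>\<^sub>1) \<theta>"
    using assms(1) concave_pair_orlicz[OF assms(5,6) _ \<phi>\<^sub>1] concave_pair_const_orlicz[OF assms(5,6) \<phi>\<^sub>1]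
    by (cases E\<^sub>0) (auto simp: nondegenerate_orlicz_def)
  interpret concave_pair "left_inv E\<^sub>0" "orlicz_inv \<phi>\<^sub>1" \<theta> by (fact pair)
  have psi: "continuous_on strip \<psi>" "\<psi> ` strip \<subseteq> cball 0 1" "\<psi> holomorphic_on interior strip"
    "inj_on \<psi> (interior strip)"
    using assms(7) by (auto simp: conformal_strip_disc_def bij_betw_def)
  interpret concave_pair_disc "left_inv E\<^sub>0" "orlicz_inv \<phi>\<^sub>1" \<theta> \<psi>
  proof
    show "bounded_holomorphic_strip \<psi>"
      using psi bounded_subset[OF bounded_cball] by (auto simp: bounded_holomorphic_strip_def)
    show "cmod (\<psi> z) \<le> 1" if "z \<in> strip" for z using psi(2) that by force
    \<comment> \<open>The zero is simple because \<open>\<psi>\<close> is injective on the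
      interior.\<close>
    show "deriv \<psi> (of_real \<theta>) \<noteq> 0"
      using psi theta_interior by (intro holomorphic_injective_imp_regular) auto
  qed fact
  show ?thesis by (rule quasi_young_Phi)
qed

end
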